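(* Let $f=h+\overline g$ be an orientation-preserving harmonic mapping in $\mathbb D$ with $\|\omega_f\|_\infty<1$. Then $$K_{\mathrm{aff}}(f)=\inf_A K(A\circ f),$$ where the infimum is over all orientation-preserving real-affine mappings $A$ of the plane. The infimum is attained. The minimizing affine mappings are precisely those $A$ whose induced disk automorphism $T_A$ sends the unique hyperbolic circumcenter of $\overline{\omega_f(\mathbb D)}$ to $0$. Any two minimizing affine mappings differ by an orientation-preserving Euclidean similarity, i.e. if $A_1,A_2$ are minimizing then $A_2=S\circ A_1$ with $S(w)=\lambda w+\gamma$ for some $\lambda,\gamma\in\mathbb C$, $\lambda\neq0$. If $f$ is globally univalent, the common minimum is the least quasiconformal constant among all mappings $A\circ f$ with $A$ an orientation-preserving real-affine mapping.
   Context: $\mathbb D$ is the open unit disk in $\mathbb C$. An orientation-preserving harmonic mapping in $\mathbb D$ is a complex-valued harmonic function $f=h+\overline g$, with $h,g$ analytic in $\mathbb D$, whose Jacobian $|h'|^2-|g'|^2$ is positive everywhere; then $h'\neq0$ and its complex dilatation $\omega_f=g'/h'$ is an analytic map $\mathbb D\to\mathbb D$. It need not be injective; (globally) univalent means injective. $\|\cdot\|_\infty$ is the supremum norm on $\mathbb D$. Maximal differential eccentricity: $K(f)=\sup_{z\in\mathbb D}\frac{1+|\omega_f(z)|}{1-|\omega_f(z)|}=\frac{1+\|\omega_f\|_\infty}{1-\|\omega_f\|_\infty}$. When $f$ is univalent with $\|\omega_f\|_\infty<1$, $K(f)$ is its quasiconformal constant as a homeomorphism onto its image. An orientation-preserving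 real-affine mapping is $A(w)=aw+b\overline w+c$ with $a,b,c\in\mathbb C$, $|a|>|b|$. Then $A\circ f$ is an orientation-preserving harmonic mapping and $\omega_{A\circ f}=T_A\circ\omega_f$, where $T_A(\zeta)=\frac{\overline a\,\zeta+\overline b}{b\,\zeta+a}$ is an automorphism of $\mathbb D$ (the induced disk automorphism). Hyperbolic distance: $d_{\mathbb D}(z_1,z_2)=2\operatorname{arctanh}\left|\frac{z_1-z_2}{1-\overline{z_2}z_1}\right|$. For a nonempty hyperbolically bounded set $E\subset\mathbb D$, the circumradius is $\operatorname{rad}_{\mathbb D}(E)=\inf_{c\in\mathbb D}\sup_{\zeta\in E}d_{\mathbb D}(c,\zeta)$; the infimum is attained at a unique point, the hyperbolic circumcenter of $E$. Put $r_{\mathrm{aff}}(f)=\operatorname{rad}_{\mathbb D}(\overline{\omega_f(\mathbb D)})$ and $K_{\mathrm{aff}}(f)=e^{r_{\mathrm{aff}}(f)}$. *)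

theory Defs
  imports "HOL-Complex_Analysis.Complex_Analysis"
begin

abbreviation unit_disk :: "complex set" where
  "unit_disk \<equiv> ball 0 1"

section \<open>Orientation-preserving harmonic mappings of the disk\<close>

text \<open>Mappings of the disk are total functions on \<open>complex\<close>; every notion below looks only at
  their values on \<open>unit_disk\<close>.\<close>

definition canonical_decomposition ::
    "(complex \<Rightarrow> complex) \<Rightarrow> (complex \<Rightarrow> complex) \<Rightarrow> (complex \<Rightarrow> complex) \<Rightarrow> bool" where
  "canonical_decomposition f h g \<longleftrightarrow>
     h holomorphic_on unit_disk \<and> g holomorphic_on unit_disk \<and>
     (\<forall>z\<in>unit_disk. f z = h z + cnj (g z))"

definition op_harmonic :: "(complex \<Rightarrow> complex) \<Rightarrow> bool" where
  "op_harmonic f \<longleftrightarrow>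
     (\<exists>h g. canonical_decomposition f h g \<and>
       (\<forall>z\<in>unit_disk. (cmod (deriv h z))\<^sup>2 - (cmod (deriv g z))\<^sup>2 > 0))"

text \<open>In a decomposition \<open>f = h + cnj g\<close> the functions \<open>h\<close> and \<open>g\<close> are unique up to additive
  constants, so \<open>g' / h'\<close> depends on \<open>f\<close> alone.\<close>

definition dilatation :: "(complex \<Rightarrow> complex) \<Rightarrow> complex \<Rightarrow> complex" where
  "dilatation f z =
     (THE w. \<exists>h g. canonical_decomposition f h g \<and> w = deriv g z / deriv h z)"

definition dilatation_norm :: "(complex \<Rightarrow> complex) \<Rightarrow> real" where
  "dilatation_norm f = (SUP z\<in>unit_disk. cmod (dilatation f z))"

text \<open>Extended-real valued, since the supremum is infinite when \<open>dilatation_norm f = 1\<close>.\<close>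

definition max_eccentricity :: "(complex \<Rightarrow> complex) \<Rightarrow> ereal" where
  "max_eccentricity f =
     (SUP z\<in>unit_disk. ereal ((1 + cmod (dilatation f z)) / (1 - cmod (dilatation f z))))"

section \<open>Real-affine mappings\<close>

definition affine_map :: "complex \<Rightarrow> complex \<Rightarrow> complex \<Rightarrow> complex \<Rightarrow> complex" where
  "affine_map a b c w = a * w + b * cnj w + c"

definition op_affine_maps :: "(complex \<Rightarrow> complex) set" where
  "op_affine_maps = {affine_map a b c | a b c. cmod b < cmod a}"

definition induced_automorphism :: "complex \<Rightarrow> complex \<Rightarrow> complex \<Rightarrow> complex" where
  "induced_automorphism a b \<zeta> = (cnj a * \<zeta> + cnj b) / (b * \<zeta> + a)"

definition minimizing_affine :: "(complex \<Rightarrow> complex) \<Rightarrow> (complex \<Rightarrow> complex) \<Rightarrow> bool" where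
  "minimizing_affine f A \<longleftrightarrow>
     A \<in> op_affine_maps \<and>
     max_eccentricity (A \<circ> f) = (INF B\<in>op_affine_maps. max_eccentricity (B \<circ> f))"

section \<open>Hyperbolic circumradius and circumcenter\<close>

definition disk_dist :: "complex \<Rightarrow> complex \<Rightarrow> real" where
  "disk_dist z\<^sub>1 z\<^sub>2 = 2 * artanh (cmod ((z\<^sub>1 - z\<^sub>2) / (1 - cnj z\<^sub>2 * z\<^sub>1)))"

text \<open>The suprema below are real suprema, meaningful for nonempty hyperbolically bounded \<open>E\<close>.\<close>

definition circumradius :: "complex set \<Rightarrow> real" where
  "circumradius E = (INF c\<in>unit_disk. SUP \<zeta>\<in>E. disk_dist c \<zeta>)"

definition is_circumcenter :: "complex set \<Rightarrow> complex \<Rightarrow> bool" where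
  "is_circumcenter E c \<longleftrightarrow>
     c \<in> unit_disk \<and> (SUP \<zeta>\<in>E. disk_dist c \<zeta>) = circumradius E"

definition circumcenter :: "complex set \<Rightarrow> complex" where
  "circumcenter E = (THE c. is_circumcenter E c)"

definition dilatation_closure :: "(complex \<Rightarrow> complex) \<Rightarrow> complex set" where
  "dilatation_closure f = closure (dilatation f ` unit_disk)"

definition r_aff :: "(complex \<Rightarrow> complex) \<Rightarrow> real" where
  "r_aff f = circumradius (dilatation_closure f)"

definition K_aff :: "(complex \<Rightarrow> complex) \<Rightarrow> real" where
  "K_aff f = exp (r_aff f)"

section \<open>Quasiconformal mappings\<close>

definition abs_continuous_on_interval ::
    "(real \<Rightarrow> complex) \<Rightarrow> real \<Rightarrow> real \<Rightarrow> bool" where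
  "abs_continuous_on_interval \<phi> a b \<longleftrightarrow>
     (\<forall>\<epsilon>>0. \<exists>\<delta>>0. \<forall>(n::nat) u v.
        (\<forall>i<n. a \<le> u i \<and> u i \<le> v i \<and> v i \<le> b) \<and>
        disjoint_family_on (\<lambda>i. {u i<..<v i}) {..<n} \<and>
        (\<Sum>i<n. v i - u i) < \<delta>
        \<longrightarrow> (\<Sum>i<n. cmod (\<phi> (v i) - \<phi> (u i))) < \<epsilon>)"

text \<open>Absolute continuity on lines: for every closed rectangle in \<open>\<Omega>\<close> with sides parallel to the
  axes (lower left corner \<open>p\<close>, upper right corner \<open>q\<close>).\<close>

definition ACL_on :: "complex set \<Rightarrow> (complex \<Rightarrow> complex) \<Rightarrow> bool" where
  "ACL_on \<Omega> F \<longleftrightarrow>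
     (\<forall>p q. Re p \<le> Re q \<and> Im p \<le> Im q \<and> cbox p q \<subseteq> \<Omega> \<longrightarrow>
        (AE y in lebesgue. y \<in> {Im p..Im q} \<longrightarrow>
           abs_continuous_on_interval (\<lambda>x. F (Complex x y)) (Re p) (Re q)) \<and>
        (AE x in lebesgue. x \<in> {Re p..Re q} \<longrightarrow>
           abs_continuous_on_interval (\<lambda>y. F (Complex x y)) (Im p) (Im q)))"

text \<open>The analytic definition of a \<open>K\<close>-quasiconformal mapping: a homeomorphism onto its image,
  absolutely continuous on lines, with
  \<open>\<bar>F_zbar\<bar> \<le> (K - 1) / (K + 1) * \<bar>F_z\<bar>\<close> almost everywhere. With the partial derivatives
  \<open>Fx\<close>, \<open>Fy\<close> one has \<open>F_z = (Fx - \<i> Fy) / 2\<close> and \<open>F_zbar = (Fx + \<i> Fy) / 2\<close>.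
  The inequality forces the
  mapping to preserve orientation.\<close>

definition quasiconformal_on ::
    "real \<Rightarrow> complex set \<Rightarrow> (complex \<Rightarrow> complex) \<Rightarrow> bool" where
  "quasiconformal_on K \<Omega> F \<longleftrightarrow>
     1 \<le> K \<and> open \<Omega> \<and> connected \<Omega> \<and>
     (\<exists>G. homeomorphism \<Omega> (F ` \<Omega>) F G) \<and>
     ACL_on \<Omega> F \<and>
     (AE z in lebesgue. z \<in> \<Omega> \<longrightarrow>
        (\<exists>Fx Fy.
           ((\<lambda>t::real. F (z + of_real t)) has_vector_derivative Fx) (at 0) \<and>
           ((\<lambda>t::real. F (z + \<i> * of_real t)) has_vector_derivative Fy) (at 0) \<and>
           cmod ((Fx + \<i> * Fy) / 2) \<le> (K - 1) / (K + 1) * cmod ((Fx - \<i> * Fy) / 2)))"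

text \<open>The least admissible \<open>K\<close>; infinite for mappings that are not quasiconformal.\<close>

definition qc_constant :: "complex set \<Rightarrow> (complex \<Rightarrow> complex) \<Rightarrow> ereal" where
  "qc_constant \<Omega> F = (INF K\<in>{K. quasiconformal_on K \<Omega> F}. ereal K)"

end

theory Submission
  imports Defs
begin

text \<open>For \<open>A w = a w + b \<cdot> cnj w + c\<close> the induced automorphism is a hyperbolic isometry that sends
  \<open>p = - cnj (b / a)\<close> to \<open>0\<close>, and \<open>(1 + \<bar>\<zeta>\<bar>) / (1 - \<bar>\<zeta>\<bar>)\<close> is the exponential of the hyperbolic
  distance from \<open>0\<close> to \<open>\<zeta>\<close>. Hence the eccentricity of \<open>A \<circ> f\<close> is the exponential of the supremum
  of the distances from \<open>p\<close> to the values of the dilatation of \<open>f\<close>. Every point of the disk occurs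
  as such a \<open>p\<close>, so minimising over \<open>A\<close> is the circumcenter problem. A minimiser exists by
  compactness. It is unique because \<open>cosh\<close> of the distance is bilinear in the hyperboloid model, so
  that the midpoint of two distinct minimisers would give a strictly smaller supremum.

  An injective harmonic mapping is a homeomorphism onto its image that is Lipschitz on compact
  rectangles, and \<open>cnj g'\<close> and \<open>h'\<close> are its Wirtinger derivatives; by continuity of the dilatation the almost
  everywhere inequality holds everywhere, so its quasiconformal constant is its eccentricity.\<close>

section \<open>Hyperbolic distance\<close>

lemma exp_two_artanh:
  fixes x :: real
  assumes "\<bar>x\<bar> < 1"
  shows "exp (2 * artanh x) = (1 + x) / (1 - x)"
  using assms by (simp add: artanh_def abs_less_iff)

lemma cosh_two_artanh:
  fixes x :: real
  assumes "\<bar>x\<bar> < 1"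
  shows "cosh (2 * artanh x) = (1 + x\<^sup>2) / (1 - x\<^sup>2)"
proof -
  have "1 + x > 0" "1 - x > 0"
    using assms by auto
  moreover have "1 - x\<^sup>2 = (1 + x) * (1 - x)"
    by (simp add: power2_eq_square algebra_simps)
  ultimately show ?thesis
    unfolding cosh_def exp_minus exp_two_artanh[OF assms]
    by (simp add: divide_simps) (simp add: power2_eq_square algebra_simps)
qed

text \<open>When the squares are expanded, the cross terms cancel and the rest factors. The product
  is positive on the disk, which puts the pseudo-hyperbolic quotient below 1; it is also the
  denominator in \<open>cosh_disk_dist\<close>.\<close>

lemma cmod_diff_one_minus_cnj_mult:
  "(cmod (1 - cnj z * c))\<^sup>2 - (cmod (c - z))\<^sup>2 = (1 - (cmod c)\<^sup>2) * (1 - (cmod z)\<^sup>2)"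
  by (simp only: cmod_power2) (simp add: power2_eq_square algebra_simps)

lemma cmod_sum_one_minus_cnj_mult:
  "(cmod (1 - cnj z * c))\<^sup>2 + (cmod (c - z))\<^sup>2
    = (1 + (cmod c)\<^sup>2) * (1 + (cmod z)\<^sup>2) - 4 * (c \<bullet> z)"
  by (simp only: cmod_power2 inner_complex_def) (simp add: power2_eq_square algebra_simps)

lemma one_minus_cmod_square_pos: "c \<in> unit_disk \<Longrightarrow> 0 < 1 - (cmod c)\<^sup>2"
  by (simp add: abs_square_less_1)

lemma pseudo_hyperbolic_less_1:
  assumes "c \<in> unit_disk" "z \<in> unit_disk"
  shows "cmod ((c - z) / (1 - cnj z * c)) < 1"
proof -
  have "(cmod (c - z))\<^sup>2 < (cmod (1 - cnj z * c))\<^sup>2"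
    using cmod_diff_one_minus_cnj_mult[of z c]
      mult_pos_pos[OF assms[THEN one_minus_cmod_square_pos]] by linarith
  then have "cmod (c - z) < cmod (1 - cnj z * c)"
    using power2_less_imp_less by fastforce
  then show ?thesis
    by (simp add: norm_divide divide_simps)
qed

lemma exp_disk_dist:
  assumes "c \<in> unit_disk" "z \<in> unit_disk"
  shows "exp (disk_dist c z) =
    (1 + cmod ((c - z) / (1 - cnj z * c))) / (1 - cmod ((c - z) / (1 - cnj z * c)))"
  unfolding disk_dist_def using pseudo_hyperbolic_less_1[OF assms] by (intro exp_two_artanh) simp

lemma disk_dist_nonneg:
  assumes "c \<in> unit_disk" "z \<in> unit_disk"
  shows "0 \<le> disk_dist c z"
proof -
  have "1 \<le> exp (disk_dist c z)"
    unfolding exp_disk_dist[OF assms] using pseudo_hyperbolic_less_1[OF assms]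
    by (subst le_divide_eq_1) auto
  then show ?thesis
    by simp
qed

lemma cosh_disk_dist:
  assumes "c \<in> unit_disk" "z \<in> unit_disk"
  shows "cosh (disk_dist c z) =
    ((cmod (1 - cnj z * c))\<^sup>2 + (cmod (c - z))\<^sup>2) / ((1 - (cmod c)\<^sup>2) * (1 - (cmod z)\<^sup>2))"
proof -
  have pos: "0 < (1 - (cmod c)\<^sup>2) * (1 - (cmod z)\<^sup>2)"
    using assms[THEN one_minus_cmod_square_pos] by (rule mult_pos_pos)
  then have "cmod (1 - cnj z * c) \<noteq> 0"
    using cmod_diff_one_minus_cnj_mult[of z c] zero_le_power2[of "cmod (c - z)"]
    by (intro notI) simp
  then have "cosh (disk_dist c z) = ((cmod (1 - cnj z * c))\<^sup>2 + (cmod (c - z))\<^sup>2) /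
      ((cmod (1 - cnj z * c))\<^sup>2 - (cmod (c - z))\<^sup>2)"
    unfolding disk_dist_def using pseudo_hyperbolic_less_1[OF assms] pos
    by (subst cosh_two_artanh)
      (auto simp: norm_divide power_divide divide_simps cmod_diff_one_minus_cnj_mult)
  then show ?thesis
    by (simp only: cmod_diff_one_minus_cnj_mult)
qed

text \<open>Clearing denominators gives a condition that is closed in \<open>c\<close> and in \<open>z\<close> on the whole
  plane, so that limits can be taken before it is known that they stay in the disk.\<close>

lemma disk_dist_le_iff:
  assumes "c \<in> unit_disk" "z \<in> unit_disk" "0 \<le> r"
  shows "disk_dist c z \<le> r \<longleftrightarrow>
    (cmod (1 - cnj z * c))\<^sup>2 + (cmod (c - z))\<^sup>2 \<le>
      cosh r * ((1 - (cmod c)\<^sup>2) * (1 - (cmod z)\<^sup>2))"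
proof -
  have "0 < (1 - (cmod c)\<^sup>2) * (1 - (cmod z)\<^sup>2)"
    using assms(1,2)[THEN one_minus_cmod_square_pos] by (rule mult_pos_pos)
  moreover have "disk_dist c z \<le> r \<longleftrightarrow> cosh (disk_dist c z) \<le> cosh r"
    using assms by (simp add: cosh_real_nonneg_le_iff disk_dist_nonneg)
  ultimately show ?thesis
    using assms by (simp add: cosh_disk_dist pos_divide_le_eq)
qed

lemma disk_dist_pos:
  assumes "c \<in> unit_disk" "z \<in> unit_disk" "c \<noteq> z"
  shows "0 < disk_dist c z"
proof (rule ccontr)
  assume "\<not> 0 < disk_dist c z"
  then have "disk_dist c z \<le> 0"
    by simp
  \<comment> \<open>With \<open>r = 0\<close> the factor \<open>cosh r\<close> is 1 and the product
    in \<open>disk_dist_le_iff\<close> is this difference of squares, so only \<open>c = z\<close>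
    remains possible.\<close>
  then have "(cmod (1 - cnj z * c))\<^sup>2 + (cmod (c - z))\<^sup>2 \<le>
      (cmod (1 - cnj z * c))\<^sup>2 - (cmod (c - z))\<^sup>2"
    using assms by (simp add: disk_dist_le_iff cmod_diff_one_minus_cnj_mult)
  then show False
    using assms by simp
qed

section \<open>The hyperboloid model\<close>

text \<open>Inverse stereographic projection from (-1, 0) lifts the disk to the upper sheet of t^2 -
  |v|^2 = 1; this is the coordinate t, and \<open>hyperboloid_space\<close> is v.\<close>

definition hyperboloid_time :: "complex \<Rightarrow> real" where
  "hyperboloid_time c = (1 + (cmod c)\<^sup>2) / (1 - (cmod c)\<^sup>2)"

definition hyperboloid_space :: "complex \<Rightarrow> complex" where
  "hyperboloid_space c = (2 / (1 - (cmod c)\<^sup>2)) *\<^sub>R c"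

lemma hyperboloid_eq:
  assumes "c \<in> unit_disk"
  shows "(hyperboloid_time c)\<^sup>2 - (cmod (hyperboloid_space c))\<^sup>2 = 1"
    and "0 < hyperboloid_time c"
proof -
  have pos: "0 < 1 - (cmod c)\<^sup>2"
    using one_minus_cmod_square_pos[OF assms] .
  then show "0 < hyperboloid_time c"
    unfolding hyperboloid_time_def by (intro divide_pos_pos) (auto intro: add_pos_nonneg)
  have "(1 + (cmod c)\<^sup>2)\<^sup>2 - (2 * cmod c)\<^sup>2 = (1 - (cmod c)\<^sup>2)\<^sup>2"
    by (simp add: power2_eq_square algebra_simps)
  then show "(hyperboloid_time c)\<^sup>2 - (cmod (hyperboloid_space c))\<^sup>2 = 1"
    using pos
    by (simp add: hyperboloid_time_def hyperboloid_space_def power_divide power_mult_distrib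
        diff_divide_distrib[symmetric])
qed

text \<open>By \<open>cmod_sum_one_minus_cnj_mult\<close> the numerator of
  \<open>cosh_disk_dist\<close> is a product of time factors minus an inner product, so the quotient
  is the Minkowski product of the lifts. Its linearity in the lift of \<open>c\<close> allows
  centers to be averaged.\<close>

lemma cosh_disk_dist_hyperboloid:
  assumes "c \<in> unit_disk" "z \<in> unit_disk"
  shows "cosh (disk_dist c z) =
    hyperboloid_time c * hyperboloid_time z - hyperboloid_space c \<bullet> hyperboloid_space z"
  unfolding cosh_disk_dist[OF assms] cmod_sum_one_minus_cnj_mult hyperboloid_time_def
    hyperboloid_space_def
  by (simp add: diff_divide_distrib)

text \<open>Stereographic projection \<open>m = v / (1 + t)\<close> inverts the lift: |v|^2 = (t -
  1)(t + 1) gives |m|^2 = (t - 1) / (t + 1) < 1.\<close>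

lemma hyperboloid_surj:
  assumes "0 < t" "t\<^sup>2 - (cmod v)\<^sup>2 = 1"
  obtains m where "m \<in> unit_disk" "hyperboloid_time m = t" "hyperboloid_space m = v"
proof
  define m where "m = (1 / (1 + t)) *\<^sub>R v"
  have v: "(cmod v)\<^sup>2 = (t - 1) * (t + 1)"
    using assms(2) by (simp add: power2_eq_square algebra_simps)
  have m: "(cmod m)\<^sup>2 = (t - 1) / (1 + t)"
    using assms(1) unfolding m_def by (simp add: power_divide v) (simp add: power2_eq_square add.commute)
  then have "1 - (cmod m)\<^sup>2 = 2 / (1 + t)" "1 + (cmod m)\<^sup>2 = 2 * t / (1 + t)"
    using assms(1) by (simp_all add: field_simps)
  then show "hyperboloid_time m = t" "hyperboloid_space m = v"
    using assms(1) by (simp_all add: hyperboloid_time_def hyperboloid_space_def m_def)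
  have "(cmod m)\<^sup>2 < 1"
    using m assms(1) by simp
  then show "m \<in> unit_disk"
    by (simp add: abs_square_less_1)
qed

text \<open>The hyperbolic midpoint is the normalised sum of the two points of the hyperboloid.\<close>

lemma hyperbolic_midpoint:
  assumes c: "c\<^sub>1 \<in> unit_disk" "c\<^sub>2 \<in> unit_disk" "c\<^sub>1 \<noteq> c\<^sub>2"
  obtains m N where "m \<in> unit_disk" "1 < N"
    "\<And>z. z \<in> unit_disk \<Longrightarrow>
      N * cosh (disk_dist m z) = (cosh (disk_dist c\<^sub>1 z) + cosh (disk_dist c\<^sub>2 z)) / 2"
proof -
  define t where "t = (hyperboloid_time c\<^sub>1 + hyperboloid_time c\<^sub>2) / 2"
  define v where "v = (1 / 2) *\<^sub>R (hyperboloid_space c\<^sub>1 + hyperboloid_space c\<^sub>2)"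
  define N where "N = sqrt (t\<^sup>2 - (cmod v)\<^sup>2)"
  \<comment> \<open>Both lifts have Minkowski norm 1 and their product is \<open>cosh\<close> of the
    distance, which determines the norm of their average. It exceeds 1 for distinct points, and this
    is the source of strictness in the uniqueness proof.\<close>
  have "t\<^sup>2 - (cmod v)\<^sup>2 = (1 + cosh (disk_dist c\<^sub>1 c\<^sub>2)) / 2"
    using hyperboloid_eq(1)[OF c(1)] hyperboloid_eq(1)[OF c(2)] cosh_disk_dist_hyperboloid[OF c(1,2)]
    unfolding t_def v_def power2_norm_eq_inner
    by (simp add: inner_add_left inner_add_right inner_commute power2_eq_square field_simps)
  moreover have "cosh 0 < cosh (disk_dist c\<^sub>1 c\<^sub>2)"
    using disk_dist_pos[OF c] by (subst cosh_real_nonneg_less_iff) auto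
  ultimately have gt: "1 < t\<^sup>2 - (cmod v)\<^sup>2"
    by simp
  then have N: "1 < N" "N\<^sup>2 = t\<^sup>2 - (cmod v)\<^sup>2"
    by (simp_all add: N_def)
  have "0 < t / N"
    using hyperboloid_eq(2)[OF c(1)] hyperboloid_eq(2)[OF c(2)] N by (simp add: t_def)
  moreover have "(t / N)\<^sup>2 - (cmod ((1 / N) *\<^sub>R v))\<^sup>2 = 1"
    using N gt by (simp add: power_divide diff_divide_distrib[symmetric])
  ultimately obtain m where m: "m \<in> unit_disk" "hyperboloid_time m = t / N"
      "hyperboloid_space m = (1 / N) *\<^sub>R v"
    by (rule hyperboloid_surj)
  show thesis
  proof (rule that[OF m(1) N(1)])
    fix z assume z: "z \<in> unit_disk"
    show "N * cosh (disk_dist m z) = (cosh (disk_dist c\<^sub>1 z) + cosh (disk_dist c\<^sub>2 z)) / 2"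
      using N(1) unfolding cosh_disk_dist_hyperboloid[OF m(1) z] cosh_disk_dist_hyperboloid[OF c(1) z]
        cosh_disk_dist_hyperboloid[OF c(2) z] m
      by (simp add: t_def v_def inner_add_left field_simps)
  qed
qed

section \<open>Circumcenters\<close>

text \<open>The real suprema below are meaningful only for bounded sets. In the quotient for
  \<open>cosh\<close> the numerator is at most 8, and the denominator stays away from 0 because
  \<open>E\<close> keeps a distance from the unit circle.\<close>

lemma disk_dist_bdd_above:
  assumes c: "c \<in> unit_disk" and E: "E \<subseteq> cball 0 k" and k: "k < 1"
  shows "bdd_above (disk_dist c ` E)"
proof (rule bdd_aboveI2)
  fix z assume "z \<in> E"
  then have z: "cmod z \<le> k" "z \<in> unit_disk"
    using E k by auto
  have "cmod (1 - cnj z * c) \<le> 2" "cmod (c - z) \<le> 2"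
    using norm_triangle_ineq4[of 1 "cnj z * c"] norm_triangle_ineq4[of c z] c z
      mult_mono[of "cmod z" 1 "cmod c" 1] by (auto simp: norm_mult)
  then have "(cmod (1 - cnj z * c))\<^sup>2 + (cmod (c - z))\<^sup>2 \<le> 2\<^sup>2 + 2\<^sup>2"
    by (intro add_mono power_mono) auto
  moreover have k1: "0 < 1 - k\<^sup>2" "1 - k\<^sup>2 \<le> 1 - (cmod z)\<^sup>2"
    using z k norm_ge_zero[of z] abs_square_less_1[of k] by (auto simp del: norm_ge_zero intro!: power_mono)
  moreover have "(1 - (cmod c)\<^sup>2) * (1 - k\<^sup>2) \<le> (1 - (cmod c)\<^sup>2) * (1 - (cmod z)\<^sup>2)"
    using k1 one_minus_cmod_square_pos[OF c] by (intro mult_left_mono) auto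
  ultimately have bound: "cosh (disk_dist c z) \<le> 8 / ((1 - (cmod c)\<^sup>2) * (1 - k\<^sup>2))"
    unfolding cosh_disk_dist[OF c z(2)] using one_minus_cmod_square_pos[OF c]
    by (intro frac_le) auto
  \<comment> \<open>A bound on \<open>cosh d\<close> bounds \<open>d\<close> itself through
    \<open>d \<le> exp d \<le> 2 * cosh d\<close>.\<close>
  have "disk_dist c z \<le> exp (disk_dist c z)"
    using exp_ge_add_one_self[of "disk_dist c z"] by linarith
  also have "\<dots> \<le> 2 * cosh (disk_dist c z)"
    using sinh_less_cosh_real[of "disk_dist c z"] sinh_plus_cosh[of "disk_dist c z"] by simp
  finally show "disk_dist c z \<le> 2 * (8 / ((1 - (cmod c)\<^sup>2) * (1 - k\<^sup>2)))"
    using bound by simp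
qed

text \<open>A point of \<open>E\<close> makes every supremum nonnegative, so the real infimum over
  centers is bounded below and is a genuine lower bound.\<close>

lemma circumradius_bounds:
  assumes E: "E \<subseteq> cball 0 k" "k < 1" "E \<noteq> {}"
  shows "0 \<le> circumradius E"
    and "c \<in> unit_disk \<Longrightarrow> circumradius E \<le> (SUP z\<in>E. disk_dist c z)"
proof -
  have nonneg: "0 \<le> (SUP z\<in>E. disk_dist c z)" if c: "c \<in> unit_disk" for c
  proof -
    obtain z where z: "z \<in> E"
      using E by auto
    then have "0 \<le> disk_dist c z"
      using E c by (intro disk_dist_nonneg) auto
    also have "\<dots> \<le> (SUP z\<in>E. disk_dist c z)"
      using disk_dist_bdd_above[OF c E(1,2)] z by (rule cSUP_upper2) simp
    finally show ?thesis .
  qed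
  then show "0 \<le> circumradius E"
    unfolding circumradius_def by (intro cINF_greatest) (auto simp: ball_eq_empty)
  assume "c \<in> unit_disk"
  moreover have "bdd_below ((\<lambda>c. SUP z\<in>E. disk_dist c z) ` unit_disk)"
    using nonneg by (rule bdd_belowI2)
  ultimately show "circumradius E \<le> (SUP z\<in>E. disk_dist c z)"
    unfolding circumradius_def by (intro cINF_lower)
qed

text \<open>A minimizing sequence has a limit point in the closed disk. The cleared form of the
  distance bound passes to the limit, and it fails on the unit circle.\<close>

lemma circumcenter_exists:
  assumes E: "E \<subseteq> cball 0 k" "k < 1" "E \<noteq> {}"
  shows "\<exists>c. is_circumcenter E c"
proof -
  define r where "r = circumradius E"
  have r: "0 \<le> r"
    using circumradius_bounds(1)[OF E] by (simp add: r_def)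
  have disk: "z \<in> unit_disk" if "z \<in> E" for z
    using that E by auto
  have "\<exists>c\<in>unit_disk. (SUP z\<in>E. disk_dist c z) < r + 1 / Suc n" for n
  proof (rule ccontr)
    assume "\<not> ?thesis"
    then have "r + 1 / Suc n \<le> circumradius E"
      unfolding circumradius_def by (intro cINF_greatest) (auto simp: not_less)
    then show False
      by (simp add: r_def)
  qed
  then obtain c where c: "\<And>n. c n \<in> unit_disk"
      "\<And>n. (SUP z\<in>E. disk_dist (c n) z) < r + 1 / Suc n"
    by metis
  have "range c \<subseteq> cball 0 1"
    using c(1) by (force simp: less_imp_le)
  then obtain l \<sigma> where l: "l \<in> cball 0 1" "strict_mono \<sigma>" "(c \<circ> \<sigma>) \<longlonglongrightarrow> l"
    using compact_imp_seq_compact[OF compact_cball, of "0::complex" 1]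
    unfolding seq_compact_def by (metis range_subsetD)
  have lim: "(\<lambda>n. c (\<sigma> n)) \<longlonglongrightarrow> l"
    using l(3) by (simp add: o_def)
  have lim_radius: "(\<lambda>n. r + 1 / Suc (\<sigma> n)) \<longlonglongrightarrow> r + 0"
    using LIMSEQ_subseq_LIMSEQ[OF LIMSEQ_inverse_real_of_nat l(2)]
    by (intro tendsto_add tendsto_const) (simp add: o_def inverse_eq_divide)
  have le: "(cmod (1 - cnj z * l))\<^sup>2 + (cmod (l - z))\<^sup>2 \<le>
      cosh r * ((1 - (cmod l)\<^sup>2) * (1 - (cmod z)\<^sup>2))" if z: "z \<in> E" for z
  proof (rule LIMSEQ_le)
    show "(\<lambda>n. (cmod (1 - cnj z * c (\<sigma> n)))\<^sup>2 + (cmod (c (\<sigma> n) - z))\<^sup>2)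
        \<longlonglongrightarrow> (cmod (1 - cnj z * l))\<^sup>2 + (cmod (l - z))\<^sup>2"
      by (intro tendsto_intros lim)
    show "(\<lambda>n. cosh (r + 1 / Suc (\<sigma> n)) * ((1 - (cmod (c (\<sigma> n)))\<^sup>2) * (1 - (cmod z)\<^sup>2)))
        \<longlonglongrightarrow> cosh r * ((1 - (cmod l)\<^sup>2) * (1 - (cmod z)\<^sup>2))"
      using lim_radius by (intro tendsto_intros lim) simp
    have "disk_dist (c n) z \<le> r + 1 / Suc n" for n
      using cSUP_upper[OF z disk_dist_bdd_above[OF c(1) E(1,2)], of n] c(2)[of n] by simp
    then have "(cmod (1 - cnj z * c n))\<^sup>2 + (cmod (c n - z))\<^sup>2 \<le>
        cosh (r + 1 / Suc n) * ((1 - (cmod (c n))\<^sup>2) * (1 - (cmod z)\<^sup>2))" for n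
      using c(1) disk[OF z] r by (subst disk_dist_le_iff[symmetric]) auto
    then show "\<exists>N. \<forall>n\<ge>N. (cmod (1 - cnj z * c (\<sigma> n)))\<^sup>2 + (cmod (c (\<sigma> n) - z))\<^sup>2 \<le>
        cosh (r + 1 / Suc (\<sigma> n)) * ((1 - (cmod (c (\<sigma> n)))\<^sup>2) * (1 - (cmod z)\<^sup>2))"
      by blast
  qed
  obtain z where z: "z \<in> E"
    using E by auto
  \<comment> \<open>On the circle the factor \<open>1 - (cmod l)\<^sup>2\<close> kills the right
    side of the bound, forcing \<open>l = z\<close> for a point \<open>z\<close> of the open
    disk.\<close>
  have "cmod l \<noteq> 1"
  proof
    assume l1: "cmod l = 1"
    then have "(cmod (1 - cnj z * l))\<^sup>2 + (cmod (l - z))\<^sup>2 \<le> 0"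
      using le[OF z] by simp
    then have "(cmod (l - z))\<^sup>2 \<le> 0"
      using zero_le_power2[of "cmod (1 - cnj z * l)"] by linarith
    then show False
      using disk[OF z] l1 by auto
  qed
  then have l_disk: "l \<in> unit_disk"
    using l(1) by auto
  have "(SUP z\<in>E. disk_dist l z) \<le> r"
    using le disk l_disk r E by (intro cSUP_least) (auto simp: disk_dist_le_iff)
  then have "is_circumcenter E l"
    using l_disk circumradius_bounds(2)[OF E l_disk] by (simp add: is_circumcenter_def r_def)
  then show ?thesis ..
qed

text \<open>At the midpoint of two circumcenters every \<open>cosh\<close> of a distance to
  \<open>E\<close> drops to at most \<open>cosh r / N\<close>. As \<open>N > 1\<close> is the same
  for all points of \<open>E\<close>, the supremum itself drops strictly below
  \<open>r\<close>.\<close>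

lemma circumcenter_unique:
  assumes E: "E \<subseteq> cball 0 k" "k < 1" "E \<noteq> {}"
    and c: "is_circumcenter E c\<^sub>1" "is_circumcenter E c\<^sub>2"
  shows "c\<^sub>1 = c\<^sub>2"
proof (rule ccontr)
  assume ne: "c\<^sub>1 \<noteq> c\<^sub>2"
  define r where "r = circumradius E"
  have r: "0 \<le> r"
    using circumradius_bounds(1)[OF E] by (simp add: r_def)
  have disk: "z \<in> unit_disk" if "z \<in> E" for z
    using that E by auto
  have c_disk: "c\<^sub>1 \<in> unit_disk" "c\<^sub>2 \<in> unit_disk"
    using c by (auto simp: is_circumcenter_def)
  obtain m N where m: "m \<in> unit_disk" and N: "1 < N"
    and mid: "\<And>z. z \<in> unit_disk \<Longrightarrow>
      N * cosh (disk_dist m z) = (cosh (disk_dist c\<^sub>1 z) + cosh (disk_dist c\<^sub>2 z)) / 2"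
    using hyperbolic_midpoint[OF c_disk ne] by blast
  have cosh_le: "cosh (disk_dist c z) \<le> cosh r" if "is_circumcenter E c" "z \<in> E" for c z
  proof -
    have "disk_dist c z \<le> r" "0 \<le> disk_dist c z"
      using that cSUP_upper[OF that(2) disk_dist_bdd_above[OF _ E(1,2)], of c] disk
      by (auto simp: is_circumcenter_def r_def intro!: disk_dist_nonneg)
    then show ?thesis
      using r by (simp add: cosh_real_nonneg_le_iff)
  qed
  have m_le: "cosh (disk_dist m z) \<le> cosh r / N" if "z \<in> E" for z
    using mid[OF disk[OF that]] cosh_le[OF c(1) that] cosh_le[OF c(2) that] N
    by (simp add: field_simps)
  obtain z where "z \<in> E"
    using E by auto
  then have ge1: "1 \<le> cosh r / N"
    using m_le cosh_real_ge_1 order_trans by blast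
  \<comment> \<open>The radius that corresponds to the improved bound; \<open>ge1\<close> ensures
    that \<open>arcosh\<close> really inverts \<open>cosh\<close> here.\<close>
  define s where "s = arcosh (cosh r / N)"
  have s: "cosh s = cosh r / N" "0 \<le> s"
    using ge1 by (auto simp: s_def)
  have "cosh s < cosh r"
    using s N by (simp add: divide_less_eq)
  then have "s < r"
    using cosh_real_nonneg_less_iff[OF s(2) r] by simp
  have "(SUP z\<in>E. disk_dist m z) \<le> s"
  proof (rule cSUP_least)
    fix z assume "z \<in> E"
    then show "disk_dist m z \<le> s"
      using m_le[of z] cosh_real_nonneg_le_iff[OF disk_dist_nonneg[OF m disk] s(2), of z]
      by (simp add: s(1))
  qed (fact E)
  then show False
    using circumradius_bounds(2)[OF E m] \<open>s < r\<close> by (simp add: r_def)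
qed

section \<open>Harmonic mappings and their dilatations\<close>

text \<open>The chain rule along the line through \<open>z\<close> in direction \<open>u\<close>;
  the directions 1 and \<open>\<i>\<close> give the two partial derivatives.\<close>

lemma canonical_decomposition_has_vector_derivative:
  assumes "canonical_decomposition f h g" "z \<in> unit_disk"
  shows "((\<lambda>t::real. f (z + u * of_real t)) has_vector_derivative
    (u * deriv h z + cnj (u * deriv g z))) (at 0)"
proof -
  let ?S = "(\<lambda>t::real. z + u * of_real t) -` unit_disk"
  have line: "((\<lambda>t::real. z + u * of_real t) has_vector_derivative u) (at 0)"
    by (auto intro!: derivative_eq_intros simp: has_vector_derivative_def scaleR_conv_of_real)
  have along: "((\<lambda>t::real. k (z + u * of_real t)) has_vector_derivative u * deriv k z) (at 0)"
    if "k holomorphic_on unit_disk" for k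
    using field_vector_diff_chain_at[OF line, of k "deriv k z"] assms(2)
      holomorphic_derivI[OF that open_ball assms(2)] by (simp add: o_def)
  have "((\<lambda>t::real. h (z + u * of_real t) + cnj (g (z + u * of_real t))) has_vector_derivative
      (u * deriv h z + cnj (u * deriv g z))) (at 0)"
    using assms along
    by (intro has_vector_derivative_add has_vector_derivative_cnj)
      (auto simp: canonical_decomposition_def)
  \<comment> \<open>\<open>f\<close> is known to equal \<open>h + cnj g\<close> only in the disk; an
    open set of parameters around 0 suffices to transfer the derivative.\<close>
  moreover have "open ?S"
    by (intro open_vimage continuous_intros) auto
  moreover have "f (z + u * of_real t) = h (z + u * of_real t) + cnj (g (z + u * of_real t))"
    if "t \<in> ?S" for t
    using assms that by (auto simp: canonical_decomposition_def)
  ultimately show ?thesis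
    using assms(2) by (elim has_vector_derivative_transform_within_open) auto
qed

lemma canonical_decomposition_wirtinger:
  assumes "canonical_decomposition f h g" "z \<in> unit_disk"
    and x: "((\<lambda>t::real. f (z + of_real t)) has_vector_derivative Fx) (at 0)"
    and y: "((\<lambda>t::real. f (z + \<i> * of_real t)) has_vector_derivative Fy) (at 0)"
  shows "(Fx - \<i> * Fy) / 2 = deriv h z" "(Fx + \<i> * Fy) / 2 = cnj (deriv g z)"
proof -
  have Fx: "Fx = deriv h z + cnj (deriv g z)"
    using vector_derivative_unique_at[OF x]
      canonical_decomposition_has_vector_derivative[OF assms(1,2), of 1] by simp
  have Fy: "Fy = \<i> * deriv h z - \<i> * cnj (deriv g z)"
    using vector_derivative_unique_at[OF y]
      canonical_decomposition_has_vector_derivative[OF assms(1,2), of \<i>] by simp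
  show "(Fx - \<i> * Fy) / 2 = deriv h z" "(Fx + \<i> * Fy) / 2 = cnj (deriv g z)"
    unfolding Fx Fy by (simp_all add: algebra_simps)
qed

text \<open>The partial derivatives of \<open>f\<close> determine \<open>deriv h z\<close> and
  \<open>deriv g z\<close>, so all decompositions give the same quotient and the definite
  description is justified.\<close>

lemma dilatation_eq:
  assumes "canonical_decomposition f h g" "z \<in> unit_disk"
  shows "dilatation f z = deriv g z / deriv h z"
  unfolding dilatation_def
proof (rule the_equality)
  fix w assume "\<exists>h g. canonical_decomposition f h g \<and> w = deriv g z / deriv h z"
  then obtain h' g' where *: "canonical_decomposition f h' g'" "w = deriv g' z / deriv h' z"
    by blast
  have x: "((\<lambda>t::real. f (z + of_real t)) has_vector_derivative
      deriv h z + cnj (deriv g z)) (at 0)"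
    using canonical_decomposition_has_vector_derivative[OF assms, of 1] by simp
  note y = canonical_decomposition_has_vector_derivative[OF assms, of \<i>]
  have "deriv h' z = deriv h z" "cnj (deriv g' z) = cnj (deriv g z)"
    using canonical_decomposition_wirtinger[OF assms x y]
      canonical_decomposition_wirtinger[OF *(1) assms(2) x y] by (metis (no_types))+
  then show "w = deriv g z / deriv h z"
    using * by simp
qed (use assms in blast)

lemma op_harmonicE:
  assumes "op_harmonic f"
  obtains h g where "canonical_decomposition f h g"
    "\<And>z. z \<in> unit_disk \<Longrightarrow> cmod (deriv g z) < cmod (deriv h z)"
proof -
  from assms obtain h g where "canonical_decomposition f h g"
    and *: "\<forall>z\<in>unit_disk. 0 < (cmod (deriv h z))\<^sup>2 - (cmod (deriv g z))\<^sup>2"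
    by (auto simp: op_harmonic_def)
  moreover have "cmod (deriv g z) < cmod (deriv h z)" if "z \<in> unit_disk" for z
    using * that power2_less_imp_less[of "cmod (deriv g z)" "cmod (deriv h z)"] by fastforce
  ultimately show thesis
    using that by blast
qed

lemma cmod_dilatation_less_1:
  assumes "op_harmonic f" "z \<in> unit_disk"
  shows "cmod (dilatation f z) < 1"
proof -
  obtain h g where "canonical_decomposition f h g" "cmod (deriv g z) < cmod (deriv h z)"
    using assms by (metis op_harmonicE)
  then show ?thesis
    using assms(2) by (simp add: dilatation_eq norm_divide divide_less_eq)
qed

lemma continuous_on_dilatation:
  assumes "op_harmonic f"
  shows "continuous_on unit_disk (dilatation f)"
proof -
  obtain h g where hg: "canonical_decomposition f h g"
    "\<And>z. z \<in> unit_disk \<Longrightarrow> cmod (deriv g z) < cmod (deriv h z)"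
    using op_harmonicE[OF assms] by blast
  have "deriv h z \<noteq> 0" if "z \<in> unit_disk" for z
    using hg(2)[OF that] by auto
  then have "continuous_on unit_disk (\<lambda>z. deriv g z / deriv h z)"
    using hg(1)
    by (intro continuous_on_divide holomorphic_on_imp_continuous_on holomorphic_deriv)
      (auto simp: canonical_decomposition_def)
  then show ?thesis
    using dilatation_eq[OF hg(1)] by (subst continuous_on_cong[OF refl]) auto
qed

section \<open>Composition with real-affine mappings\<close>

text \<open>Conjugating \<open>f\<close> exchanges the roles of \<open>h\<close> and
  \<open>g\<close>, so \<open>b * cnj f\<close> adds \<open>b * g\<close> to the analytic part and
  \<open>cnj b * h\<close> to the conjugated one.\<close>

lemma canonical_decomposition_affine:
  assumes "canonical_decomposition f h g"
  shows "canonical_decomposition (affine_map a b c \<circ> f)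
    (\<lambda>z. a * h z + b * g z + c) (\<lambda>z. cnj a * g z + cnj b * h z)"
  using assms unfolding canonical_decomposition_def
  by (auto intro!: holomorphic_intros simp: affine_map_def algebra_simps)

lemma canonical_decomposition_affine_deriv:
  assumes "canonical_decomposition f h g" "z \<in> unit_disk"
  shows "deriv (\<lambda>z. a * h z + b * g z + c) z = a * deriv h z + b * deriv g z"
    and "deriv (\<lambda>z. cnj a * g z + cnj b * h z) z = cnj a * deriv g z + cnj b * deriv h z"
proof -
  have "(h has_field_derivative deriv h z) (at z)" "(g has_field_derivative deriv g z) (at z)"
    using assms by (auto simp: canonical_decomposition_def intro!: holomorphic_derivI[OF _ open_ball])
  then show "deriv (\<lambda>z. a * h z + b * g z + c) z = a * deriv h z + b * deriv g z"
    and "deriv (\<lambda>z. cnj a * g z + cnj b * h z) z = cnj a * deriv g z + cnj b * deriv h z"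
    by (auto intro!: DERIV_imp_deriv derivative_eq_intros)
qed

lemma op_harmonic_affine:
  assumes "op_harmonic f" "cmod b < cmod a"
  shows "op_harmonic (affine_map a b c \<circ> f)"
proof -
  obtain h g where hg: "canonical_decomposition f h g"
    "\<And>z. z \<in> unit_disk \<Longrightarrow> cmod (deriv g z) < cmod (deriv h z)"
    using op_harmonicE[OF assms(1)] by blast
  \<comment> \<open>Multiplicativity of the Jacobian: the first factor belongs to the affine map,
    the second to \<open>f\<close>.\<close>
  have "(cmod (a * p + b * q))\<^sup>2 - (cmod (cnj a * q + cnj b * p))\<^sup>2 =
      ((cmod a)\<^sup>2 - (cmod b)\<^sup>2) * ((cmod p)\<^sup>2 - (cmod q)\<^sup>2)" for p q
    by (simp only: cmod_power2) (simp add: power2_eq_square algebra_simps)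
  then show ?thesis
    using hg assms(2) canonical_decomposition_affine[OF hg(1), of a b c]
    unfolding op_harmonic_def
    by (intro exI[of _ "\<lambda>z. a * h z + b * g z + c"] exI[of _ "\<lambda>z. cnj a * g z + cnj b * h z"])
      (auto simp: canonical_decomposition_affine_deriv[OF hg(1)] intro!: power_strict_mono mult_pos_pos)
qed

lemma dilatation_affine:
  assumes "op_harmonic f" "z \<in> unit_disk"
  shows "dilatation (affine_map a b c \<circ> f) z = induced_automorphism a b (dilatation f z)"
proof -
  obtain h g where hg: "canonical_decomposition f h g" "cmod (deriv g z) < cmod (deriv h z)"
    using assms by (metis op_harmonicE)
  then have "deriv h z \<noteq> 0"
    by auto
  then have "(cnj a * deriv g z + cnj b * deriv h z) / (a * deriv h z + b * deriv g z) =
      ((cnj a * (deriv g z / deriv h z) + cnj b) * deriv h z) /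
      ((b * (deriv g z / deriv h z) + a) * deriv h z)"
    by (simp add: distrib_right add.commute)
  also have "\<dots> = induced_automorphism a b (deriv g z / deriv h z)"
    using \<open>deriv h z \<noteq> 0\<close> by (simp add: induced_automorphism_def)
  finally show ?thesis
    using assms(2) canonical_decomposition_affine[OF hg(1), of a b c] hg(1)
    by (simp add: dilatation_eq canonical_decomposition_affine_deriv)
qed

text \<open>The zero of the induced automorphism; the induced automorphism is an isometry, so the
  eccentricity of \<open>A \<circ> f\<close> measures hyperbolic distances from this point.\<close>

definition affine_center :: "complex \<Rightarrow> complex \<Rightarrow> complex" where
  "affine_center a b = - cnj (b / a)"

lemma affine_center_in_disk: "cmod b < cmod a \<Longrightarrow> affine_center a b \<in> unit_disk"
  by (simp add: affine_center_def norm_divide divide_less_eq)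

lemma induced_automorphism_zero_iff:
  assumes "cmod b < cmod a" "z \<in> unit_disk"
  shows "induced_automorphism a b z = 0 \<longleftrightarrow> z = affine_center a b"
proof -
  have "a \<noteq> 0"
    using assms by auto
  \<comment> \<open>Division by zero yields 0, so a vanishing denominator would be a spurious zero;
    this estimate excludes it.\<close>
  have "cmod (b * z) < cmod a"
    using assms mult_mono[of "cmod b" "cmod b" "cmod z" 1] by (simp add: norm_mult)
  then have "b * z + a \<noteq> 0"
    by (metis add_eq_0_iff norm_minus_cancel order_less_irrefl)
  then have "induced_automorphism a b z = 0 \<longleftrightarrow> cnj a * z + cnj b = 0"
    by (simp add: induced_automorphism_def)
  also have "\<dots> \<longleftrightarrow> z = affine_center a b"
    using \<open>a \<noteq> 0\<close> by (simp add: affine_center_def field_simps eq_neg_iff_add_eq_0)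
  finally show ?thesis .
qed

text \<open>Up to factors of modulus |a|, which cancel, numerator and denominator are
  \<open>c - z\<close> and the conjugate of \<open>1 - cnj z * c\<close>. This is the isometry
  property in the only form needed, distances to 0.\<close>

lemma cmod_induced_automorphism:
  fixes a b z
  assumes "a \<noteq> 0"
  defines "c \<equiv> affine_center a b"
  shows "cmod (induced_automorphism a b z) = cmod ((c - z) / (1 - cnj z * c))"
proof -
  have "cnj a * z + cnj b = - cnj a * (c - z)" "b * z + a = a * cnj (1 - cnj z * c)"
    using assms(1) by (simp_all add: c_def affine_center_def field_simps)
  then show ?thesis
    using assms(1) by (simp add: induced_automorphism_def norm_divide norm_mult 
        del: complex_cnj_diff complex_cnj_mult)
qed

section \<open>Eccentricity of the affine images\<close>

lemma dilatation_closure_subset: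
  assumes "op_harmonic f"
  shows "dilatation_closure f \<subseteq> cball 0 (dilatation_norm f)"
proof -
  have "bdd_above ((\<lambda>z. cmod (dilatation f z)) ` unit_disk)"
    using cmod_dilatation_less_1[OF assms] by (intro bdd_aboveI2[of _ _ 1]) (simp add: less_imp_le)
  then have "dilatation f ` unit_disk \<subseteq> cball 0 (dilatation_norm f)"
    by (auto simp: dilatation_norm_def intro!: cSUP_upper2[of "\<lambda>z. cmod (dilatation f z)"])
  then show ?thesis
    unfolding dilatation_closure_def by (intro closure_minimal) auto
qed

lemma dilatation_closure_nonempty: "dilatation_closure f \<noteq> {}"
  by (simp add: dilatation_closure_def)

text \<open>The eccentricity sees the values of the dilatation, the circumradius their closure. The
  cleared inequality cuts out a closed set, so a bound on the values extends to the closure, which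
  lies in the disk since the dilatation norm is below 1.\<close>

lemma dilatation_closure_disk_dist_le_iff:
  assumes f: "op_harmonic f" "dilatation_norm f < 1" and c: "c \<in> unit_disk" and r: "0 \<le> r"
  shows "(SUP z\<in>dilatation_closure f. disk_dist c z) \<le> r \<longleftrightarrow>
    (\<forall>z\<in>unit_disk. disk_dist c (dilatation f z) \<le> r)"
proof
  assume le: "(SUP z\<in>dilatation_closure f. disk_dist c z) \<le> r"
  show "\<forall>z\<in>unit_disk. disk_dist c (dilatation f z) \<le> r"
  proof
    fix z assume "z \<in> unit_disk"
    then have "dilatation f z \<in> dilatation_closure f"
      unfolding dilatation_closure_def by (intro subsetD[OF closure_subset] imageI)
    then have "disk_dist c (dilatation f z) \<le> (SUP z\<in>dilatation_closure f. disk_dist c z)"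
      using disk_dist_bdd_above[OF c dilatation_closure_subset[OF f(1)] f(2)] by (rule cSUP_upper)
    then show "disk_dist c (dilatation f z) \<le> r"
      using le by (rule order_trans)
  qed
next
  assume le: "\<forall>z\<in>unit_disk. disk_dist c (dilatation f z) \<le> r"
  let ?S = "{z. (cmod (1 - cnj z * c))\<^sup>2 + (cmod (c - z))\<^sup>2 \<le>
      cosh r * ((1 - (cmod c)\<^sup>2) * (1 - (cmod z)\<^sup>2))}"
  have "closed ?S"
    by (intro closed_Collect_le continuous_intros)
  moreover have "dilatation f ` unit_disk \<subseteq> ?S"
    using le cmod_dilatation_less_1[OF f(1)] c r by (auto simp: disk_dist_le_iff[symmetric])
  ultimately have "dilatation_closure f \<subseteq> ?S"
    unfolding dilatation_closure_def by (intro closure_minimal)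
  moreover have "dilatation_closure f \<subseteq> unit_disk"
    using dilatation_closure_subset[OF f(1)] f(2) by force
  ultimately show "(SUP z\<in>dilatation_closure f. disk_dist c z) \<le> r"
    using c r
    by (intro cSUP_least dilatation_closure_nonempty) (subst disk_dist_le_iff, auto)
qed

lemma max_eccentricity_affine:
  assumes f: "op_harmonic f" "dilatation_norm f < 1" and ab: "cmod b < cmod a"
  shows "max_eccentricity (affine_map a b c \<circ> f) =
    ereal (exp (SUP z\<in>dilatation_closure f. disk_dist (affine_center a b) z))"
proof -
  define p where "p = affine_center a b"
  define R where "R = (SUP z\<in>dilatation_closure f. disk_dist p z)"
  have a: "a \<noteq> 0"
    using ab by auto
  have p: "p \<in> unit_disk"
    unfolding p_def using affine_center_in_disk[OF ab] .
  have w: "dilatation f z \<in> unit_disk" if "z \<in> unit_disk" for z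
    using cmod_dilatation_less_1[OF f(1) that] by simp
  have "(1 + cmod (dilatation (affine_map a b c \<circ> f) z)) /
      (1 - cmod (dilatation (affine_map a b c \<circ> f) z)) = exp (disk_dist p (dilatation f z))"
    if z: "z \<in> unit_disk" for z
    using z w[OF z] p a f(1)
    by (simp add: exp_disk_dist dilatation_affine cmod_induced_automorphism p_def)
  then have eq: "max_eccentricity (affine_map a b c \<circ> f) =
      (SUP z\<in>unit_disk. ereal (exp (disk_dist p (dilatation f z))))"
    unfolding max_eccentricity_def by (intro SUP_cong) auto
  have upper: "disk_dist p (dilatation f z) \<le> r \<Longrightarrow> 0 \<le> r" if "z \<in> unit_disk" for z r
    using disk_dist_nonneg[OF p w[OF that]] by simp
  have R: "0 \<le> R"
    using circumradius_bounds[OF dilatation_closure_subset[OF f(1)] f(2) dilatation_closure_nonempty] p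
    unfolding R_def by force
  have "(SUP z\<in>unit_disk. ereal (exp (disk_dist p (dilatation f z)))) = ereal (exp R)"
  proof (rule SUP_eqI)
    fix z assume "z \<in> unit_disk"
    then show "ereal (exp (disk_dist p (dilatation f z))) \<le> ereal (exp R)"
      using dilatation_closure_disk_dist_le_iff[OF f p R] R_def by simp
  next
    \<comment> \<open>A finite upper bound is positive because it dominates an exponential, so
      \<open>ln\<close> turns it into a bound on distances.\<close>
    fix y assume y: "\<And>z. z \<in> unit_disk \<Longrightarrow> ereal (exp (disk_dist p (dilatation f z))) \<le> y"
    show "ereal (exp R) \<le> y"
    proof (cases y)
      case (real s)
      have le: "exp (disk_dist p (dilatation f z)) \<le> s" if "z \<in> unit_disk" for z
        using y[OF that] real by simp
      have "0 < s"
        using less_le_trans[OF exp_gt_zero le[of 0]] by simp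
      then have le_ln: "disk_dist p (dilatation f z) \<le> ln s" if "z \<in> unit_disk" for z
        using le[OF that] by (simp add: ln_ge_iff)
      then have "R \<le> ln s"
        using upper[of 0 "ln s"] dilatation_closure_disk_dist_le_iff[OF f p, of "ln s"]
        by (simp add: R_def)
      then show ?thesis
        using \<open>0 < s\<close> real by (simp add: ln_ge_iff)
    next
      case MInf
      then show ?thesis
        using y[of 0] by simp
    qed simp
  qed
  then show ?thesis
    by (simp add: eq R_def p_def)
qed

section \<open>Quasiconformality\<close>

text \<open>Clearing positive denominators turns the eccentricity bound into the Beltrami inequality
  of \<open>quasiconformal_on\<close>.\<close>

lemma max_eccentricity_le_iff:
  assumes "op_harmonic F" "1 \<le> K"
  shows "max_eccentricity F \<le> ereal K \<longleftrightarrow>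
    (\<forall>z\<in>unit_disk. cmod (dilatation F z) \<le> (K - 1) / (K + 1))"
proof -
  have "(1 + cmod (dilatation F z)) / (1 - cmod (dilatation F z)) \<le> K \<longleftrightarrow>
      cmod (dilatation F z) \<le> (K - 1) / (K + 1)" if "z \<in> unit_disk" for z
    using cmod_dilatation_less_1[OF assms(1) that] assms(2) by (auto simp: field_simps)
  then show ?thesis
    by (simp add: max_eccentricity_def SUP_le_iff)
qed

lemma quasiconformal_on_imp_max_eccentricity_le:
  assumes F: "op_harmonic F" and qc: "quasiconformal_on K unit_disk F"
  shows "max_eccentricity F \<le> ereal K"
proof -
  obtain h g where hg: "canonical_decomposition F h g"
    "\<And>z. z \<in> unit_disk \<Longrightarrow> cmod (deriv g z) < cmod (deriv h z)"
    using op_harmonicE[OF F] by blast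
  have K: "1 \<le> K"
    using qc by (simp add: quasiconformal_on_def)
  \<comment> \<open>The points that violate the bound. \<open>V\<close> is open by continuity and
    null by quasiconformality, hence empty.\<close>
  define V where "V = {z \<in> unit_disk. (K - 1) / (K + 1) < cmod (dilatation F z)}"
  have "V = (\<lambda>z. cmod (dilatation F z)) -` {(K - 1) / (K + 1)<..} \<inter> unit_disk"
    by (auto simp: V_def)
  then have "open V"
    using continuous_on_norm[OF continuous_on_dilatation[OF F]]
    by (simp add: continuous_on_open_vimage)
  have "AE z in lebesgue. z \<in> unit_disk \<longrightarrow> (\<exists>Fx Fy.
      ((\<lambda>t::real. F (z + of_real t)) has_vector_derivative Fx) (at 0) \<and>
      ((\<lambda>t::real. F (z + \<i> * of_real t)) has_vector_derivative Fy) (at 0) \<and>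
      cmod ((Fx + \<i> * Fy) / 2) \<le> (K - 1) / (K + 1) * cmod ((Fx - \<i> * Fy) / 2))"
    using qc unfolding quasiconformal_on_def by blast
  then have "AE z in lebesgue. z \<notin> V"
  proof (rule AE_mp, intro AE_I2 impI notI)
    fix z assume "z \<in> V" and *: "z \<in> unit_disk \<longrightarrow> (\<exists>Fx Fy.
      ((\<lambda>t::real. F (z + of_real t)) has_vector_derivative Fx) (at 0) \<and>
      ((\<lambda>t::real. F (z + \<i> * of_real t)) has_vector_derivative Fy) (at 0) \<and>
      cmod ((Fx + \<i> * Fy) / 2) \<le> (K - 1) / (K + 1) * cmod ((Fx - \<i> * Fy) / 2))"
    from \<open>z \<in> V\<close> have z: "z \<in> unit_disk" "(K - 1) / (K + 1) < cmod (dilatation F z)"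
      by (auto simp: V_def)
    have "cmod (deriv g z) \<le> (K - 1) / (K + 1) * cmod (deriv h z)"
      using * z(1) canonical_decomposition_wirtinger[OF hg(1) z(1)] by (metis complex_mod_cnj)
    moreover have "0 < cmod (deriv h z)"
      using hg(2)[OF z(1)] norm_ge_zero[of "deriv g z"] by linarith
    ultimately show False
      using z by (simp add: dilatation_eq[OF hg(1)] norm_divide pos_less_divide_eq)
  qed
  then have "V \<in> null_sets lebesgue"
    using \<open>open V\<close> by (simp add: AE_iff_null_sets)
  then have "V = {}"
    using \<open>open V\<close> open_not_negligible by (auto simp: negligible_iff_null_sets)
  then show ?thesis
    using K unfolding max_eccentricity_le_iff[OF F K] V_def by fastforce
qed

section \<open>Absolute continuity on lines\<close>

lemma lipschitz_imp_abs_continuous: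
  assumes "\<And>x y. x \<in> {a..b} \<Longrightarrow> y \<in> {a..b} \<Longrightarrow> cmod (\<phi> x - \<phi> y) \<le> B * \<bar>x - y\<bar>"
  shows "abs_continuous_on_interval \<phi> a b"
  unfolding abs_continuous_on_interval_def
proof (intro allI impI)
  fix \<epsilon> :: real assume "0 < \<epsilon>"
  \<comment> \<open>\<open>\<bar>B\<bar> + 1\<close> is a positive Lipschitz constant whatever the
    sign of \<open>B\<close>.\<close>
  have \<delta>: "0 < \<epsilon> / (\<bar>B\<bar> + 1)"
    using \<open>0 < \<epsilon>\<close> by (simp add: divide_pos_pos)
  show "\<exists>\<delta>>0. \<forall>(n::nat) u v. (\<forall>i<n. a \<le> u i \<and> u i \<le> v i \<and> v i \<le> b) \<and>
        disjoint_family_on (\<lambda>i. {u i<..<v i}) {..<n} \<and> (\<Sum>i<n. v i - u i) < \<delta> \<longrightarrow>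
        (\<Sum>i<n. cmod (\<phi> (v i) - \<phi> (u i))) < \<epsilon>"
  proof (intro exI[of _ "\<epsilon> / (\<bar>B\<bar> + 1)"] conjI \<delta> allI impI, elim conjE)
    fix n :: nat and u v :: "nat \<Rightarrow> real"
    assume uv: "\<forall>i<n. a \<le> u i \<and> u i \<le> v i \<and> v i \<le> b"
      and small: "(\<Sum>i<n. v i - u i) < \<epsilon> / (\<bar>B\<bar> + 1)"
    have "cmod (\<phi> (v i) - \<phi> (u i)) \<le> (\<bar>B\<bar> + 1) * (v i - u i)" if "i < n" for i
    proof -
      have "a \<le> u i" "u i \<le> v i" "v i \<le> b"
        using uv that by auto
      then have "cmod (\<phi> (v i) - \<phi> (u i)) \<le> B * (v i - u i)"
        using assms[of "v i" "u i"] by simp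
      also have "\<dots> \<le> (\<bar>B\<bar> + 1) * (v i - u i)"
        using \<open>u i \<le> v i\<close> by (intro mult_right_mono) auto
      finally show ?thesis .
    qed
    then have "(\<Sum>i<n. cmod (\<phi> (v i) - \<phi> (u i))) \<le> (\<bar>B\<bar> + 1) * (\<Sum>i<n. v i - u i)"
      unfolding sum_distrib_left by (intro sum_mono) auto
    also have "\<dots> < \<epsilon>"
      using small by (simp add: pos_less_divide_eq mult.commute)
    finally show "(\<Sum>i<n. cmod (\<phi> (v i) - \<phi> (u i))) < \<epsilon>" .
  qed
qed

text \<open>The derivative is bounded on the compact box, and convexity of the box turns this into a
  Lipschitz bound.\<close>

lemma holomorphic_lipschitz_on_cbox:
  assumes "k holomorphic_on S" "open S" "cbox p q \<subseteq> S"
  obtains B where "\<And>x y. x \<in> cbox p q \<Longrightarrow> y \<in> cbox p q \<Longrightarrow> cmod (k x - k y) \<le> B * cmod (x - y)"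
proof -
  have "continuous_on (cbox p q) (deriv k)"
    using assms by (meson continuous_on_subset holomorphic_deriv holomorphic_on_imp_continuous_on)
  then have "bounded (deriv k ` cbox p q)"
    by (intro compact_imp_bounded compact_continuous_image compact_cbox)
  then obtain B where B: "\<And>x. x \<in> cbox p q \<Longrightarrow> cmod (deriv k x) \<le> B"
    by (auto simp: bounded_iff)
  have "(k has_field_derivative deriv k x) (at x within cbox p q)" if "x \<in> cbox p q" for x
    using holomorphic_derivI[OF assms(1,2)] assms(3) that has_field_derivative_at_within by blast
  then show thesis
    using B by (intro that field_differentiable_bound[OF convex_box(1)]) auto
qed

lemma canonical_decomposition_ACL_on:
  assumes "canonical_decomposition F h g"
  shows "ACL_on unit_disk F"
  unfolding ACL_on_def
proof (intro allI impI, elim conjE)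
  fix p q assume sub: "cbox p q \<subseteq> unit_disk"
  have hol: "h holomorphic_on unit_disk" "g holomorphic_on unit_disk"
    and F: "\<And>z. z \<in> unit_disk \<Longrightarrow> F z = h z + cnj (g z)"
    using assms by (auto simp: canonical_decomposition_def)
  obtain B C where B: "\<And>x y. x \<in> cbox p q \<Longrightarrow> y \<in> cbox p q \<Longrightarrow> cmod (h x - h y) \<le> B * cmod (x - y)"
    and C: "\<And>x y. x \<in> cbox p q \<Longrightarrow> y \<in> cbox p q \<Longrightarrow> cmod (g x - g y) \<le> C * cmod (x - y)"
    using holomorphic_lipschitz_on_cbox[OF hol(1) open_ball sub]
      holomorphic_lipschitz_on_cbox[OF hol(2) open_ball sub] by metis
  have lip: "cmod (F x - F y) \<le> (B + C) * cmod (x - y)" if "x \<in> cbox p q" "y \<in> cbox p q" for x y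
  proof -
    have "F x - F y = (h x - h y) + cnj (g x - g y)"
      using that sub by (simp add: F subset_iff)
    then have "cmod (F x - F y) \<le> cmod (h x - h y) + cmod (cnj (g x - g y))"
      using norm_triangle_ineq by metis
    then show ?thesis
      using B[OF that] C[OF that] by (simp only: complex_mod_cnj distrib_right)
  qed
  \<comment> \<open>The Lipschitz bound works on every segment, so no exceptional null set of lines
    arises.\<close>
  have horizontal: "abs_continuous_on_interval (\<lambda>x. F (Complex x y)) (Re p) (Re q)"
    if "y \<in> {Im p..Im q}" for y
  proof (rule lipschitz_imp_abs_continuous)
    fix s t assume "s \<in> {Re p..Re q}" "t \<in> {Re p..Re q}"
    then show "cmod (F (Complex s y) - F (Complex t y)) \<le> (B + C) * \<bar>s - t\<bar>"
      using that lip[of "Complex s y" "Complex t y"]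
      by (simp add: in_cbox_complex_iff complex_diff cmod_def)
  qed
  have vertical: "abs_continuous_on_interval (\<lambda>y. F (Complex x y)) (Im p) (Im q)"
    if "x \<in> {Re p..Re q}" for x
  proof (rule lipschitz_imp_abs_continuous)
    fix s t assume "s \<in> {Im p..Im q}" "t \<in> {Im p..Im q}"
    then show "cmod (F (Complex x s) - F (Complex x t)) \<le> (B + C) * \<bar>s - t\<bar>"
      using that lip[of "Complex x s" "Complex x t"]
      by (simp add: in_cbox_complex_iff complex_diff cmod_def)
  qed
  show "(AE y in lebesgue. y \<in> {Im p..Im q} \<longrightarrow>
      abs_continuous_on_interval (\<lambda>x. F (Complex x y)) (Re p) (Re q)) \<and>
    (AE x in lebesgue. x \<in> {Re p..Re q} \<longrightarrow>
      abs_continuous_on_interval (\<lambda>y. F (Complex x y)) (Im p) (Im q))"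
    using horizontal vertical by (intro conjI AE_I2 impI)
qed

lemma quasiconformal_on_max_eccentricity:
  assumes F: "op_harmonic F" "inj_on F unit_disk"
    and K: "1 \<le> K" "max_eccentricity F \<le> ereal K"
  shows "quasiconformal_on K unit_disk F"
proof -
  obtain h g where hg: "canonical_decomposition F h g"
    "\<And>z. z \<in> unit_disk \<Longrightarrow> cmod (deriv g z) < cmod (deriv h z)"
    using op_harmonicE[OF F(1)] by blast
  have "continuous_on unit_disk (\<lambda>z. h z + cnj (g z))"
    using hg(1) by (intro continuous_intros holomorphic_on_imp_continuous_on)
      (auto simp: canonical_decomposition_def)
  then have "continuous_on unit_disk F"
    using hg(1) unfolding canonical_decomposition_def by (subst continuous_on_cong[OF refl]) auto
  \<comment> \<open>Invariance of domain: a continuous injection of an open subset of the plane is a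
    homeomorphism onto its image.\<close>
  then obtain G where "homeomorphism unit_disk (F ` unit_disk) F G"
    using invariance_of_domain_homeomorphism[OF open_ball _ order_refl F(2)] by blast
  moreover have "\<exists>Fx Fy.
      ((\<lambda>t::real. F (z + of_real t)) has_vector_derivative Fx) (at 0) \<and>
      ((\<lambda>t::real. F (z + \<i> * of_real t)) has_vector_derivative Fy) (at 0) \<and>
      cmod ((Fx + \<i> * Fy) / 2) \<le> (K - 1) / (K + 1) * cmod ((Fx - \<i> * Fy) / 2)"
    if z: "z \<in> unit_disk" for z
  proof -
    have dx: "((\<lambda>t::real. F (z + of_real t)) has_vector_derivative
        deriv h z + cnj (deriv g z)) (at 0)"
      using canonical_decomposition_has_vector_derivative[OF hg(1) z, of 1] by simp
    note dy = canonical_decomposition_has_vector_derivative[OF hg(1) z, of \<i>]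
    have "0 < cmod (deriv h z)"
      using hg(2)[OF z] norm_ge_zero[of "deriv g z"] by linarith
    moreover have "cmod (deriv g z / deriv h z) \<le> (K - 1) / (K + 1)"
      using max_eccentricity_le_iff[OF F(1) K(1)] K(2) z dilatation_eq[OF hg(1) z] by metis
    ultimately have "cmod (deriv g z) \<le> (K - 1) / (K + 1) * cmod (deriv h z)"
      by (simp only: norm_divide pos_divide_le_eq)
    then show ?thesis
      using dx dy canonical_decomposition_wirtinger[OF hg(1) z dx dy] by (metis complex_mod_cnj)
  qed
  ultimately show ?thesis
    unfolding quasiconformal_on_def using K(1) canonical_decomposition_ACL_on[OF hg(1)]
    by (auto intro!: AE_I2)
qed

lemma max_eccentricity_le_qc_constant:
  assumes "op_harmonic F"
  shows "max_eccentricity F \<le> qc_constant unit_disk F"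
  unfolding qc_constant_def
  using quasiconformal_on_imp_max_eccentricity_le[OF assms] by (intro INF_greatest) simp

section \<open>The minimization over affine mappings\<close>

theorem theorem1p1:
  fixes f :: "complex \<Rightarrow> complex"
  assumes "op_harmonic f"
    and "dilatation_norm f < 1"
  shows "ereal (K_aff f) = (INF A\<in>op_affine_maps. max_eccentricity (A \<circ> f))
    \<and> (\<exists>A. minimizing_affine f A)
    \<and> (\<exists>!c. is_circumcenter (dilatation_closure f) c)
    \<and> (\<forall>a b c. cmod b < cmod a \<longrightarrow>
         (minimizing_affine f (affine_map a b c) \<longleftrightarrow>
          induced_automorphism a b (circumcenter (dilatation_closure f)) = 0))
    \<and> (\<forall>A\<^sub>1 A\<^sub>2. minimizing_affine f A\<^sub>1 \<and> minimizing_affine f A\<^sub>2 \<longrightarrow>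
         (\<exists>l m. l \<noteq> 0 \<and> A\<^sub>2 = (\<lambda>w. l * w + m) \<circ> A\<^sub>1))
    \<and> (inj_on f unit_disk \<longrightarrow>
         (\<exists>A\<in>op_affine_maps. qc_constant unit_disk (A \<circ> f) = ereal (K_aff f)) \<and>
         (\<forall>A\<in>op_affine_maps. ereal (K_aff f) \<le> qc_constant unit_disk (A \<circ> f)))"
proof -
  define E where "E = dilatation_closure f"
  define C where "C = circumcenter E"
  note E = dilatation_closure_subset[OF assms(1)] assms(2) dilatation_closure_nonempty[of f]
  have ecc: "max_eccentricity (affine_map a b c \<circ> f) =
      ereal (exp (SUP z\<in>E. disk_dist (affine_center a b) z))" if "cmod b < cmod a" for a b c
    using max_eccentricity_affine[OF assms that] by (simp add: E_def)
  have ex1: "\<exists>!c. is_circumcenter E c"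
    unfolding E_def using circumcenter_exists[OF E] circumcenter_unique[OF E] by blast
  then have C: "is_circumcenter E C"
    unfolding C_def circumcenter_def by (rule theI')
  then have C_disk: "C \<in> unit_disk" and C_sup: "(SUP z\<in>E. disk_dist C z) = circumradius E"
    by (auto simp: is_circumcenter_def)
  have lower: "ereal (K_aff f) \<le> max_eccentricity (A \<circ> f)" if A: "A \<in> op_affine_maps" for A
  proof -
    obtain a b c where abc: "A = affine_map a b c" "cmod b < cmod a"
      using A by (auto simp: op_affine_maps_def)
    then show ?thesis
      using circumradius_bounds(2)[OF E affine_center_in_disk[OF abc(2)]]
      by (simp add: ecc K_aff_def r_aff_def E_def)
  qed
  \<comment> \<open>Coefficients chosen so that \<open>affine_center 1 (- cnj C) = C\<close>; any
    translation part would do.\<close>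
  define A\<^sub>0 where "A\<^sub>0 = affine_map 1 (- cnj C) 0"
  have less: "cmod (- cnj C) < cmod 1"
    using C_disk by simp
  then have A\<^sub>0: "A\<^sub>0 \<in> op_affine_maps"
    unfolding op_affine_maps_def A\<^sub>0_def by blast
  have "affine_center 1 (- cnj C) = C"
    by (simp add: affine_center_def)
  then have A\<^sub>0_ecc: "max_eccentricity (A\<^sub>0 \<circ> f) = ereal (K_aff f)"
    using ecc[OF less, of 0] C_sup by (simp add: A\<^sub>0_def K_aff_def r_aff_def E_def)
  have INF: "(INF A\<in>op_affine_maps. max_eccentricity (A \<circ> f)) = ereal (K_aff f)"
    using lower A\<^sub>0 A\<^sub>0_ecc by (intro antisym INF_greatest) (auto intro: INF_lower2)
  have min_iff: "minimizing_affine f (affine_map a b c) \<longleftrightarrow> affine_center a b = C"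
    if ab: "cmod b < cmod a" for a b c
  proof -
    have "affine_map a b c \<in> op_affine_maps"
      using ab by (auto simp: op_affine_maps_def)
    \<comment> \<open>\<open>exp\<close> is injective, so attaining \<open>K_aff f\<close> means
      that the supremum of the distances is the circumradius.\<close>
    then have "minimizing_affine f (affine_map a b c) \<longleftrightarrow> is_circumcenter E (affine_center a b)"
      using affine_center_in_disk[OF ab]
      by (simp add: minimizing_affine_def INF ecc[OF ab] K_aff_def r_aff_def E_def is_circumcenter_def)
    then show ?thesis
      using ex1 C by auto
  qed
  have auto_iff: "minimizing_affine f (affine_map a b c) \<longleftrightarrow> induced_automorphism a b C = 0"
    if ab: "cmod b < cmod a" for a b c
    using min_iff[OF ab] induced_automorphism_zero_iff[OF ab C_disk]
    by auto
  have similar: "\<exists>l m. l \<noteq> 0 \<and> A\<^sub>2 = (\<lambda>w. l * w + m) \<circ> A\<^sub>1"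
    if A: "minimizing_affine f A\<^sub>1" "minimizing_affine f A\<^sub>2" for A\<^sub>1 A\<^sub>2
  proof -
    obtain a\<^sub>1 b\<^sub>1 c\<^sub>1 a\<^sub>2 b\<^sub>2 c\<^sub>2 where A\<^sub>1: "A\<^sub>1 = affine_map a\<^sub>1 b\<^sub>1 c\<^sub>1" "cmod b\<^sub>1 < cmod a\<^sub>1"
      and A\<^sub>2: "A\<^sub>2 = affine_map a\<^sub>2 b\<^sub>2 c\<^sub>2" "cmod b\<^sub>2 < cmod a\<^sub>2"
      using A unfolding minimizing_affine_def op_affine_maps_def by blast
    have nz: "a\<^sub>1 \<noteq> 0" "a\<^sub>2 \<noteq> 0"
      using A\<^sub>1 A\<^sub>2 by auto
    have "cnj (b\<^sub>1 / a\<^sub>1) = cnj (b\<^sub>2 / a\<^sub>2)"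
      using A A\<^sub>1 A\<^sub>2 min_iff unfolding affine_center_def by (metis neg_equal_iff_equal)
    \<comment> \<open>A common center fixes the ratio \<open>b / a\<close>, so the linear parts are
      proportional, and \<open>l = a\<^sub>2 / a\<^sub>1\<close> is the factor of the
      similarity.\<close>
    then have "b\<^sub>1 / a\<^sub>1 = b\<^sub>2 / a\<^sub>2"
      by (simp only: complex_cnj_cancel_iff)
    then have "a\<^sub>2 = a\<^sub>2 / a\<^sub>1 * a\<^sub>1" "b\<^sub>2 = a\<^sub>2 / a\<^sub>1 * b\<^sub>1"
      using nz by (simp_all add: field_simps)
    then obtain l where l: "a\<^sub>2 = l * a\<^sub>1" "b\<^sub>2 = l * b\<^sub>1"
      by blast
    then have "A\<^sub>2 = (\<lambda>w. l * w + (c\<^sub>2 - l * c\<^sub>1)) \<circ> A\<^sub>1"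
      by (simp add: A\<^sub>1 A\<^sub>2 affine_map_def fun_eq_iff algebra_simps)
    moreover have "l \<noteq> 0"
      using l nz by auto
    ultimately show ?thesis
      by blast
  qed
  have harmonic: "op_harmonic (A \<circ> f)" if "A \<in> op_affine_maps" for A
    using that op_harmonic_affine[OF assms(1)] by (auto simp: op_affine_maps_def)
  have qc_lower: "ereal (K_aff f) \<le> qc_constant unit_disk (A \<circ> f)" if "A \<in> op_affine_maps" for A
    using lower[OF that] max_eccentricity_le_qc_constant[OF harmonic[OF that]] by (rule order_trans)
  have qc_attained: "qc_constant unit_disk (A\<^sub>0 \<circ> f) = ereal (K_aff f)" if inj: "inj_on f unit_disk"
  proof (rule antisym)
    have "inj A\<^sub>0"
    proof (rule injI)
      fix v w assume "A\<^sub>0 v = A\<^sub>0 w"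
      \<comment> \<open>Since |C| < 1, comparing moduli forces \<open>v = w\<close>.\<close>
      then have "v - w = cnj C * cnj (v - w)"
        by (simp add: A\<^sub>0_def affine_map_def algebra_simps)
      then have "cmod (v - w) = cmod C * cmod (v - w)"
        by (metis complex_mod_cnj norm_mult)
      then show "v = w"
        using C_disk by auto
    qed
    then have "inj_on (A\<^sub>0 \<circ> f) unit_disk"
      using inj by (meson comp_inj_on inj_on_subset subset_UNIV)
    moreover have "1 \<le> K_aff f"
      using circumradius_bounds(1)[OF E] by (simp add: K_aff_def r_aff_def)
    ultimately have "quasiconformal_on (K_aff f) unit_disk (A\<^sub>0 \<circ> f)"
      using A\<^sub>0_ecc by (intro quasiconformal_on_max_eccentricity harmonic A\<^sub>0) simp_all
    then show "qc_constant unit_disk (A\<^sub>0 \<circ> f) \<le> ereal (K_aff f)"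
      unfolding qc_constant_def by (intro INF_lower) simp
  qed (fact qc_lower[OF A\<^sub>0])
  have "minimizing_affine f A\<^sub>0"
    using A\<^sub>0 A\<^sub>0_ecc by (simp add: minimizing_affine_def INF)
  then show ?thesis
    using INF ex1 auto_iff similar qc_lower qc_attained A\<^sub>0
    unfolding E_def[symmetric] C_def[symmetric] by auto
qed

end
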